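(* Let $n\in\mathbb{N}$, let $\mu$ be a finite measure on $\mathcal{T}=[0,1]$, and let $\bar t=(t_0,\ldots,t_{n-1})\in\mathcal{T}^{n}$. For every two mixed-consumption Nash equilibria $s,s'$ in the $n$-producers consumer game $(\mu;\bar t)$ and for every $j\in\mathbb{P}_n$, we have $\ell^s_j=\ell^{s'}_j$.
   Context: Notation: $\mathbb{N}=\{0,1,2,\ldots\}$, $\mathcal{T}=[0,1]$ (with the Borel $\sigma$-algebra), $\mathbb{P}_n=\{0,1,\ldots,n-1\}$. Consumer game $(\mu;\bar t)$. Consumers form a continuum; consumer types $d\in\mathcal{T}$ are distributed according to the finite measure $\mu$. Producer $j\in\mathbb{P}_n$ has level $t_j\in\mathcal{T}$. The strategies available to type $d$ are $S_d=\{j\in\mathbb{P}_n\mid t_j\le d\}\cup\{\lnot\}$, where $\lnot$ is a symbol meaning "not consuming". Put $S=\mathbb{P}_n\cup\{\lnot\}$ and, for nonempty $S'\subseteq S$, $\Delta^{S'}=\{x\in[0,1]^S\mid \sum_{j\in S'}x_j=1,\ x_j=0 \text{ for } j\in S\setminus S'\}$. A mixed-consumption profile is a measurable function $s:\mathcal{T}\to[0,1]^S$ with $s(d)\in\Delta^{S_d}$ for every $d\in\mathcal{T}$; its loads are $\ell^s_j=\int_{\mathcal{T}}s_j\,d\mu$ for $j\in S$. It is a mixed-consumption Nash equilibrium if for every $d\in\mathcal{T}$: (a) $\lnot\in\operatorname{supp}(s(d))$ only if $S_d=\{\lnot\}$; and (b) $\ell^s_k\le\ell^s_j$ for every $k\in\operatorname{supp}(s(d))$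 and every $j\in S_d\setminus\{\lnot\}$. Here $\operatorname{supp}(s(d))=\{k\in S\mid s_k(d)>0\}$. *)

theory Defs
  imports "HOL-Analysis.Analysis"
begin

abbreviation types :: "real set"
  where "types \<equiv> {0..1}"

text \<open>
  A strategy is an element of \<open>nat option\<close>: \<open>Some j\<close> stands for consuming from producer \<open>j\<close>,
  and \<open>None\<close> for not consuming.
\<close>

definition strategies :: "nat \<Rightarrow> nat option set"
  where "strategies n = insert None (Some ` {..<n})"

definition available :: "nat \<Rightarrow> (nat \<Rightarrow> real) \<Rightarrow> real \<Rightarrow> nat option set"
  where "available n t d = {Some j | j. j < n \<and> t j \<le> d} \<union> {None}"

text \<open>
  The elements of \<open>[0,1]\<^sup>S\<close> are the extensional functions in \<open>S \<rightarrow>\<^sub>E {0..1}\<close>, so that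
  \<open>[0,1]\<^sup>S\<close> is the space of the product measurable space used in \<open>mixed_profile\<close>.
\<close>

definition simplex_on :: "'k set \<Rightarrow> 'k set \<Rightarrow> ('k \<Rightarrow> real) set"
  where "simplex_on S S' =
    {x \<in> S \<rightarrow>\<^sub>E {0..1}. (\<Sum>j\<in>S'. x j) = 1 \<and> (\<forall>j\<in>S - S'. x j = 0)}"

definition mixed_profile ::
    "nat \<Rightarrow> (nat \<Rightarrow> real) \<Rightarrow> (real \<Rightarrow> nat option \<Rightarrow> real) \<Rightarrow> bool"
  where "mixed_profile n t s \<longleftrightarrow>
    s \<in> restrict_space borel types
          \<rightarrow>\<^sub>M (\<Pi>\<^sub>M j\<in>strategies n. restrict_space borel {0..1}) \<and>
    (\<forall>d\<in>types. s d \<in> simplex_on (strategies n) (available n t d))"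

definition load :: "real measure \<Rightarrow> (real \<Rightarrow> nat option \<Rightarrow> real) \<Rightarrow> nat option \<Rightarrow> real"
  where "load \<mu> s j = (\<integral>d. s d j \<partial>\<mu>)"

definition supp :: "nat \<Rightarrow> (nat option \<Rightarrow> real) \<Rightarrow> nat option set"
  where "supp n x = {k \<in> strategies n. x k > 0}"

definition mixed_nash_equilibrium ::
    "nat \<Rightarrow> real measure \<Rightarrow> (nat \<Rightarrow> real) \<Rightarrow> (real \<Rightarrow> nat option \<Rightarrow> real) \<Rightarrow> bool"
  where "mixed_nash_equilibrium n \<mu> t s \<longleftrightarrow>
    mixed_profile n t s \<and>
    (\<forall>d\<in>types.
      (None \<in> supp n (s d) \<longrightarrow> available n t d = {None}) \<and>
      (\<forall>k\<in>supp n (s d). \<forall>j\<in>available n t d - {None}. load \<mu> s k \<le> load \<mu> s j))"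

end

theory Submission
  imports Defs
begin

text \<open>
  Equilibria solve a monotone variational inequality. In an equilibrium \<open>s\<close> every type puts its
  mass on available producers of least load, so replacing its choice by the one prescribed by
  another equilibrium \<open>s'\<close> cannot lower the average of the loads \<open>\<ell>\<^sub>j\<close> of \<open>s\<close> that it experiences.
  Integrating over the types gives \<open>\<Sum>\<^sub>j \<ell>\<^sub>j \<ell>\<^sub>j \<le> \<Sum>\<^sub>j \<ell>'\<^sub>j \<ell>\<^sub>j\<close>. Adding the same inequality with the roles
  of \<open>s\<close> and \<open>s'\<close> exchanged yields \<open>\<Sum>\<^sub>j (\<ell>\<^sub>j - \<ell>'\<^sub>j)\<^sup>2 \<le> 0\<close>.
\<close>

lemma mixed_profile_range:
  assumes "mixed_profile n t s" "d \<in> types" "k \<in> strategies n"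
  shows "s d k \<in> {0..1}"
  using assms unfolding mixed_profile_def simplex_on_def by fast

lemma mixed_profile_unavailable:
  assumes "mixed_profile n t s" "d \<in> types" "k \<in> strategies n" "k \<notin> available n t d"
  shows "s d k = 0"
  using assms unfolding mixed_profile_def simplex_on_def by blast

lemma mixed_profile_sum:
  assumes "mixed_profile n t s" "d \<in> types"
  shows "s d None + (\<Sum>j<n. s d (Some j)) = 1"
proof -
  have sub: "available n t d \<subseteq> strategies n"
    by (auto simp: available_def strategies_def)
  have fin: "finite (strategies n)"
    by (simp add: strategies_def)
  have "1 = (\<Sum>k\<in>available n t d. s d k)"
    using assms by (auto simp: mixed_profile_def simplex_on_def)
  also have "\<dots> = (\<Sum>k\<in>strategies n. s d k)"
    using sub fin mixed_profile_unavailable[OF assms] by (intro sum.mono_neutral_left) auto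
  also have "\<dots> = s d None + (\<Sum>j<n. s d (Some j))"
    by (simp add: strategies_def image_iff sum.reindex)
  finally show ?thesis by simp
qed

text \<open>Coordinates of a measurable map into a product are measurable, and here they are bounded
  by 1 on a space of finite measure.\<close>

lemma load_integrable:
  assumes "finite_measure \<mu>" "sets \<mu> = sets (restrict_space borel types)"
    and "mixed_profile n t s" "k \<in> strategies n"
  shows "integrable \<mu> (\<lambda>d. s d k)"
proof -
  interpret finite_measure \<mu> by fact
  have "(\<lambda>d. s d k) \<in> restrict_space borel types \<rightarrow>\<^sub>M restrict_space borel {0..1}"
    using assms(3,4) unfolding mixed_profile_def
    by (auto intro: measurable_compose[OF _ measurable_component_singleton])
  then have "(\<lambda>d. s d k) \<in> borel_measurable (restrict_space borel types)"
    by (simp add: measurable_restrict_space2_iff)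
  then have "(\<lambda>d. s d k) \<in> borel_measurable \<mu>"
    using assms(2) by (simp cong: measurable_cong_sets)
  moreover have "space \<mu> = types"
    using sets_eq_imp_space_eq[OF assms(2)] by (simp add: space_restrict_space)
  then have "AE d in \<mu>. norm (s d k) \<le> 1"
    using mixed_profile_range[OF assms(3) _ assms(4)] by (intro AE_I2) auto
  ultimately show ?thesis
    by (intro integrable_const_bound)
qed

text \<open>The right-hand side does not mention \<open>s\<close>: any two equilibria give a type
  the same total producer mass, which makes their choices comparable.\<close>

lemma equilibrium_producer_mass:
  assumes "mixed_nash_equilibrium n \<mu> t s" "d \<in> types"
  shows "(\<Sum>j<n. s d (Some j)) = (if available n t d = {None} then 0 else 1)"
proof (cases "available n t d = {None}")
  case True
  then show ?thesis
    using assms mixed_profile_unavailable[of n t s d]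
    by (auto simp: mixed_nash_equilibrium_def strategies_def intro!: sum.neutral)
next
  case False
  have prof: "mixed_profile n t s"
    using assms(1) by (simp add: mixed_nash_equilibrium_def)
  have "None \<notin> supp n (s d)"
    using assms False by (auto simp: mixed_nash_equilibrium_def)
  then have "s d None = 0"
    using mixed_profile_range[OF prof assms(2), of None]
    by (auto simp: supp_def strategies_def)
  then show ?thesis
    using mixed_profile_sum[OF prof assms(2)] False by simp
qed

text \<open>The loads of \<open>s\<close> act as fixed prices. Every producer that \<open>s\<close>
  uses at \<open>d\<close> is a cheapest available one, and \<open>s'\<close> spreads the same mass
  over available producers.\<close>

lemma equilibrium_pointwise_optimal:
  assumes eq: "mixed_nash_equilibrium n \<mu> t s" and eq': "mixed_nash_equilibrium n \<nu> t s'"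
    and d: "d \<in> types"
  shows "(\<Sum>j<n. s d (Some j) * load \<mu> s (Some j)) \<le> (\<Sum>j<n. s' d (Some j) * load \<mu> s (Some j))"
proof -
  define x y L where "x = (\<lambda>j. s d (Some j))" and "y = (\<lambda>j. s' d (Some j))"
    and "L = (\<lambda>j. load \<mu> s (Some j))"
  have prof: "mixed_profile n t s" and prof': "mixed_profile n t s'"
    using eq eq' by (simp_all add: mixed_nash_equilibrium_def)
  \<comment> \<open>If both weights are positive, \<open>k\<close> is in the support of
    \<open>s d\<close> and \<open>j\<close> is available, so the equilibrium condition compares
    their loads; otherwise both sides vanish.\<close>
  have term_le: "x k * y j * L k \<le> x k * y j * L j" if "k < n" "j < n" for k j
  proof (cases "x k > 0 \<and> y j > 0")
    case True
    have "Some j \<in> available n t d"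
      using mixed_profile_unavailable[OF prof' d, of "Some j"] True that
      by (auto simp: y_def strategies_def)
    moreover have "Some k \<in> supp n (s d)"
      using True that by (auto simp: x_def supp_def strategies_def)
    ultimately have "L k \<le> L j"
      using eq d by (auto simp: mixed_nash_equilibrium_def L_def)
    then show ?thesis
      using True by (intro mult_left_mono) auto
  next
    case False
    have "x k \<ge> 0" "y j \<ge> 0"
      using mixed_profile_range[OF prof d, of "Some k"] mixed_profile_range[OF prof' d, of "Some j"]
        that by (auto simp: x_def y_def strategies_def)
    with False have "x k = 0 \<or> y j = 0" by linarith
    then show ?thesis by auto
  qed
  have mass: "sum x {..<n} = (if available n t d = {None} then 0 else 1)"
    "sum y {..<n} = (if available n t d = {None} then 0 else 1)"
    using equilibrium_producer_mass[OF eq d] equilibrium_producer_mass[OF eq' d]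
    by (simp_all add: x_def y_def)
  have "(\<Sum>j<n. x j * L j) \<le> (\<Sum>j<n. y j * L j)"
  proof (cases "available n t d = {None}")
    case True
    then have "x j = 0 \<and> y j = 0" if "j < n" for j
      using that mixed_profile_unavailable[OF prof d, of "Some j"]
        mixed_profile_unavailable[OF prof' d, of "Some j"]
      by (auto simp: x_def y_def strategies_def)
    then show ?thesis by simp
  next
    case False
    \<comment> \<open>Multiplying each side by the other profile's mass, which is 1, couples
      \<open>x\<close> and \<open>y\<close> through the product weights \<open>x k * y j\<close>, so
      that \<open>term_le\<close> applies termwise.\<close>
    have "(\<Sum>k<n. x k * L k) = (\<Sum>k<n. x k * L k) * sum y {..<n}"
      using False mass by simp
    also have "\<dots> = (\<Sum>k<n. \<Sum>j<n. x k * y j * L k)"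
      unfolding sum_product by (simp add: mult_ac)
    also have "\<dots> \<le> (\<Sum>k<n. \<Sum>j<n. x k * y j * L j)"
      by (intro sum_mono term_le) auto
    also have "\<dots> = sum x {..<n} * (\<Sum>j<n. y j * L j)"
      unfolding sum_product by (simp add: mult_ac)
    also have "\<dots> = (\<Sum>j<n. y j * L j)"
      using False mass by simp
    finally show ?thesis .
  qed
  then show ?thesis by (simp add: x_def y_def L_def)
qed

lemma equilibrium_variational_inequality:
  assumes fin: "finite_measure \<mu>" and sets: "sets \<mu> = sets (restrict_space borel types)"
    and eq: "mixed_nash_equilibrium n \<mu> t s" and eq': "mixed_nash_equilibrium n \<nu> t s'"
  shows "(\<Sum>j<n. load \<mu> s (Some j) * load \<mu> s (Some j))
    \<le> (\<Sum>j<n. load \<mu> s' (Some j) * load \<mu> s (Some j))"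
proof -
  have int: "integrable \<mu> (\<lambda>d. r d (Some j))" if "mixed_profile n t r" "j < n" for r j
    using load_integrable[OF fin sets that(1)] that(2) by (simp add: strategies_def)
  have prof: "mixed_profile n t s" "mixed_profile n t s'"
    using eq eq' by (simp_all add: mixed_nash_equilibrium_def)
  \<comment> \<open>The factor \<open>load \<mu> s (Some j)\<close> is constant in \<open>d\<close>,
    so integration acts on \<open>r\<close> alone and turns its weights into loads.\<close>
  have expand: "(\<integral>d. (\<Sum>j<n. r d (Some j) * load \<mu> s (Some j)) \<partial>\<mu>)
      = (\<Sum>j<n. load \<mu> r (Some j) * load \<mu> s (Some j))" if "mixed_profile n t r" for r
  proof -
    have "(\<integral>d. (\<Sum>j<n. r d (Some j) * load \<mu> s (Some j)) \<partial>\<mu>)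
        = (\<Sum>j<n. (\<integral>d. r d (Some j) * load \<mu> s (Some j) \<partial>\<mu>))"
      using int[OF that] by (intro Bochner_Integration.integral_sum) auto
    then show ?thesis by (simp add: load_def)
  qed
  have "(\<integral>d. (\<Sum>j<n. s d (Some j) * load \<mu> s (Some j)) \<partial>\<mu>)
      \<le> (\<integral>d. (\<Sum>j<n. s' d (Some j) * load \<mu> s (Some j)) \<partial>\<mu>)"
  proof (rule integral_mono)
    fix d assume "d \<in> space \<mu>"
    then have "d \<in> types"
      using sets_eq_imp_space_eq[OF sets] by (simp add: space_restrict_space)
    then show "(\<Sum>j<n. s d (Some j) * load \<mu> s (Some j))
        \<le> (\<Sum>j<n. s' d (Some j) * load \<mu> s (Some j))"
      by (rule equilibrium_pointwise_optimal[OF eq eq'])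
  qed (auto intro!: Bochner_Integration.integrable_sum integrable_mult_left int prof)
  then show ?thesis by (simp only: expand prof)
qed

theorem theorem3p11:
  fixes n :: nat and \<mu> :: "real measure" and t :: "nat \<Rightarrow> real"
    and s s' :: "real \<Rightarrow> nat option \<Rightarrow> real" and j :: nat
  assumes "finite_measure \<mu>"
    and "sets \<mu> = sets (restrict_space borel types)"
    and "\<forall>i<n. t i \<in> types"
    and "mixed_nash_equilibrium n \<mu> t s"
    and "mixed_nash_equilibrium n \<mu> t s'"
    and "j < n"
  shows "load \<mu> s (Some j) = load \<mu> s' (Some j)"
proof -
  define a b where "a = (\<lambda>i. load \<mu> s (Some i))" and "b = (\<lambda>i. load \<mu> s' (Some i))"
  \<comment> \<open>The terms are grouped so that each difference is nonpositive by one of the two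
    instances of the variational inequality.\<close>
  have "(\<Sum>i<n. (a i - b i)\<^sup>2)
      = (\<Sum>i<n. a i * a i) - (\<Sum>i<n. b i * a i) + ((\<Sum>i<n. b i * b i) - (\<Sum>i<n. a i * b i))"
    unfolding sum_subtractf[symmetric] sum.distrib[symmetric]
    by (simp add: power2_eq_square algebra_simps)
  also have "\<dots> \<le> 0"
    using equilibrium_variational_inequality[OF assms(1,2,4,5)]
      equilibrium_variational_inequality[OF assms(1,2,5,4)]
    by (simp add: a_def b_def)
  finally have "(\<Sum>i<n. (a i - b i)\<^sup>2) = 0"
    by (intro antisym sum_nonneg) auto
  then have "(a j - b j)\<^sup>2 = 0"
    using assms(6) by (subst (asm) sum_nonneg_eq_0_iff) auto
  then show ?thesis by (simp add: a_def b_def)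
qed

end
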